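(* Let $\mu$ be a symmetric probability measure on $\mathbb{R}$ (i.e. $\mu(-dx)=\mu(dx)$) all of whose moments are finite, and suppose that its Jacobi sequence $\{\omega_n\}_{n\ge 1}$ satisfies $\omega_n>0$ for all $n\ge 1$ and $$\lim_{n\to\infty}\frac{\omega_{n+1}}{\omega_n}=1.$$ For $n\ge 1$ let $P_n$ be the normalized orthogonal polynomial of degree $n$ of $\mu$, and define the measure $$\mu_n(dx):=|P_n(\sqrt{2\omega_n}\,x)|^2\,\mu(\sqrt{2\omega_n}\,dx).$$ Then, as $n\to\infty$, $\mu_n$ converges weakly to the arcsine law $$\mu_{As}(dx)=\frac{1}{\pi}\frac{dx}{\sqrt{2-x^2}}\qquad(-\sqrt{2}<x<\sqrt{2}).$$
   Context: Let $\mu$ be a probability measure on $\mathbb{R}$ with finite moments of all orders. Let $\{p_n\}_{n\ge 0}$ be its monic orthogonal polynomials ($p_n$ monic of degree $n$, pairwise orthogonal in $L^2(\mathbb{R},\mu)$), obtained from $1,x,x^2,\dots$ by the Gram–Schmidt procedure. There are real numbers $\alpha_{n+1}$ ($n\ge 0$) and $\omega_n$ ($n\ge 1$) such that $$x\,p_n(x)=p_{n+1}(x)+\alpha_{n+1}p_n(x)+\omega_n p_{n-1}(x),\qquad p_{-1}\equiv 0;$$ $\{\omega_n\}_{n\ge 1}$ is called the Jacobi sequence of $\mu$. If $\mu$ is symmetric then $\alpha_n=0$ for all $n$. The normalized orthogonal polynomial is $P_n=p_n/\|p_n\|_{L^2(\mathbb{R},\mu)}$. For $c>0$, $\mu(c\,dx)$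 denotes the rescaled measure $B\mapsto\mu(cB)$, i.e. the push-forward of $\mu$ under $x\mapsto x/c$. Thus $\mu_n$ is the push-forward under $x\mapsto x/\sqrt{2\omega_n}$ of the probability measure $|P_n(x)|^2\mu(dx)$. *)

theory Defs
  imports "HOL-Probability.Probability" "HOL-Computational_Algebra.Polynomial"
begin

definition symmetric_measure :: "real measure \<Rightarrow> bool" where
  "symmetric_measure M \<longleftrightarrow> distr M borel uminus = M"

definition all_moments_finite :: "real measure \<Rightarrow> bool" where
  "all_moments_finite M \<longleftrightarrow> (\<forall>k::nat. integrable M (\<lambda>x. x ^ k))"

definition monic_orthogonal_polys :: "real measure \<Rightarrow> (nat \<Rightarrow> real poly) \<Rightarrow> bool" where
  "monic_orthogonal_polys M p \<longleftrightarrow>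
     (\<forall>n. degree (p n) = n \<and> lead_coeff (p n) = 1) \<and>
     (\<forall>m n. m \<noteq> n \<longrightarrow> (\<integral>x. poly (p m) x * poly (p n) x \<partial>M) = 0)"

text \<open>The three-term recurrence is an identity of polynomials, with the convention that
  the polynomial of index -1 is zero. In particular the value of \<open>\<omega>\<close> at 0 is unconstrained.
  If \<open>M\<close> has finite support, orthogonality alone does not determine \<open>p n\<close> for all \<open>n\<close>; but then
  some \<open>\<omega> n\<close> with \<open>n \<ge> 1\<close> vanishes for every choice of \<open>p\<close>, so when \<open>\<omega>\<close> is
  positive both \<open>p\<close> and the values \<open>\<omega> n\<close> for \<open>n \<ge> 1\<close> are determined by \<open>M\<close>.\<close>

definition jacobi_sequence :: "(nat \<Rightarrow> real poly) \<Rightarrow> (nat \<Rightarrow> real) \<Rightarrow> bool" where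
  "jacobi_sequence p \<omega> \<longleftrightarrow>
     (\<exists>\<alpha>::nat \<Rightarrow> real. \<forall>n.
        [:0, 1:] * p n = p (n + 1) + smult (\<alpha> (n + 1)) (p n)
                         + (if n = 0 then 0 else smult (\<omega> n) (p (n - 1))))"

definition L2_norm_poly :: "real measure \<Rightarrow> real poly \<Rightarrow> real" where
  "L2_norm_poly M q = sqrt (\<integral>x. \<bar>poly q x\<bar>\<^sup>2 \<partial>M)"

definition normalized_poly :: "real measure \<Rightarrow> real poly \<Rightarrow> real poly" where
  "normalized_poly M q = smult (1 / L2_norm_poly M q) q"

definition rescaled_measure :: "real \<Rightarrow> real measure \<Rightarrow> real measure" where
  "rescaled_measure c M = distr M borel (\<lambda>x. x / c)"

definition scaled_poly_measure ::
    "real measure \<Rightarrow> (nat \<Rightarrow> real poly) \<Rightarrow> (nat \<Rightarrow> real) \<Rightarrow> nat \<Rightarrow> real measure" where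
  "scaled_poly_measure M p \<omega> n =
     density (rescaled_measure (sqrt (2 * \<omega> n)) M)
       (\<lambda>x. ennreal (\<bar>poly (normalized_poly M (p n)) (sqrt (2 * \<omega> n) * x)\<bar>\<^sup>2))"

definition arcsine_law :: "real measure" where
  "arcsine_law = density lborel
     (\<lambda>x. ennreal (indicator {- sqrt 2<..<sqrt 2} x * (1 / pi) * (1 / sqrt (2 - x\<^sup>2))))"

end

theory Submission
  imports Defs
begin

text \<open>Multiplication by \<open>x\<close> is tridiagonal in the orthonormal basis \<open>P n\<close>: by symmetry its diagonal
  vanishes, and its off-diagonal entries are \<open>sqrt (\<omega> n)\<close>. Since \<open>\<omega> (n + 1) / \<omega> n\<close> tends to 1,
  around position \<open>n\<close> the matrix divided by \<open>sqrt (\<omega> n)\<close> approaches the adjacency matrix of the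
  integers, which the Fourier transform turns into multiplication by \<open>2 cos u\<close>. Hence the
  moments of the rescaled measures tend to those of \<open>sqrt 2 * cos u\<close> with \<open>u\<close> uniform, which
  is arcsine distributed. As the arcsine law has bounded support, Taylor expansion of the
  characteristic functions and Levy's continuity theorem give weak convergence.\<close>

section \<open>The method of moments\<close>

text \<open>Allows index 0 to be dropped: positivity of \<open>\<omega>\<close>, and with it every
  fact about the scaled measures, starts at index 1.\<close>

lemma weak_conv_m_Suc:
  assumes "weak_conv_m (\<lambda>n. M (Suc n)) N"
  shows "weak_conv_m M N"
  using assms unfolding weak_conv_m_def weak_conv_def
  by (auto intro: LIMSEQ_imp_Suc)

text \<open>The moments of \<open>N\<close> grow at most geometrically, so factorials beat them in
  the Taylor remainder of \<open>char N t\<close>. The remainder of \<open>char (M n) t\<close> is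
  controlled by a moment of the same order, which converges; no uniform bound on the supports of the
  \<open>M n\<close> enters.\<close>

lemma weak_conv_m_of_moments:
  fixes M :: "nat \<Rightarrow> real measure" and N :: "real measure"
  assumes M: "\<And>n. real_distribution (M n)" and N: "real_distribution N"
    and int_M: "\<And>n k. integrable (M n) (\<lambda>x. x ^ k)"
    and bounded: "AE x in N. \<bar>x\<bar> \<le> B"
    and conv: "\<And>k. (\<lambda>n. \<integral>x. x ^ k \<partial>M n) \<longlonglongrightarrow> (\<integral>x. x ^ k \<partial>N)"
  shows "weak_conv_m M N"
proof (rule levy_continuity[OF M N])
  fix t :: real
  interpret M: real_distribution "M n" for n by (rule M)
  interpret N: real_distribution N by (rule N)
  have bdd: "AE x in N. norm (x ^ k) \<le> \<bar>B\<bar> ^ k" for k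
    using bounded by eventually_elim (auto simp: power_abs intro!: power_mono)
  have int_N: "integrable N (\<lambda>x. x ^ k)" for k
    by (rule N.integrable_const_bound[OF bdd]) auto
  have moment_le: "(\<integral>x. x ^ k \<partial>N) \<le> \<bar>B\<bar> ^ k" for k
    using bdd[of k] int_N[of k] by (intro N.integral_le_const) (auto elim: eventually_mono)
  define T where "T K k = (\<Sum>j\<le>k. ((\<i> * t) ^ j / fact j) * (\<integral>x. x ^ j \<partial>K))" for K :: "real measure" and k
  \<comment> \<open>At even order the absolute moment in the remainder bound is an ordinary moment,
    to which \<open>conv\<close> applies.\<close>
  have abs_even: "(\<lambda>x::real. \<bar>x\<bar> ^ (2*k)) = (\<lambda>x. x ^ (2*k))" for k
    by (auto simp: power_mult)
  have approx_M: "cmod (char (M n) t - T (M n) (2*k)) \<le>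
      (2 * \<bar>t\<bar> ^ (2*k) / fact (2*k)) * (\<integral>x. x ^ (2*k) \<partial>M n)" for n k
    using M.char_approx1[of "2*k" n t] int_M unfolding T_def abs_even by simp
  have approx_N: "cmod (char N t - T N (2*k)) \<le>
      (2 * \<bar>t\<bar> ^ (2*k) / fact (2*k)) * (\<integral>x. x ^ (2*k) \<partial>N)" for k
    using N.char_approx1[of "2*k" t] int_N unfolding T_def abs_even by simp
  have T_conv: "(\<lambda>n. T (M n) k) \<longlonglongrightarrow> T N k" for k
    unfolding T_def by (intro tendsto_intros conv)
  show "(\<lambda>n. char (M n) t) \<longlonglongrightarrow> char N t"
  proof (rule LIMSEQ_I)
    fix e :: real assume "e > 0"
    \<comment> \<open>These are twice the terms of the exponential series at
      \<open>\<bar>t\<bar> * \<bar>B\<bar>\<close>. They bound the remainder for \<open>N\<close>,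
      so the order \<open>2*k\<close> is fixed before \<open>n\<close> is chosen.\<close>
    have "(\<lambda>k. 2 * ((\<bar>t\<bar> * \<bar>B\<bar>) ^ k /\<^sub>R fact k)) \<longlonglongrightarrow> 2 * 0"
      by (intro tendsto_intros summable_LIMSEQ_zero summable_exp_generic)
    moreover have "filterlim (\<lambda>k::nat. 2 * k) sequentially sequentially"
      by (rule filterlim_subseq) (auto simp: strict_mono_def)
    ultimately have "(\<lambda>k. 2 * ((\<bar>t\<bar> * \<bar>B\<bar>) ^ (2*k) /\<^sub>R fact (2*k))) \<longlonglongrightarrow> 2 * 0"
      by (rule filterlim_compose)
    then have "\<forall>\<^sub>F k in sequentially. 2 * ((\<bar>t\<bar> * \<bar>B\<bar>) ^ (2*k) /\<^sub>R fact (2*k)) < e/4"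
      by (rule order_tendstoD) (use \<open>e > 0\<close> in simp)
    then obtain k where k: "2 * ((\<bar>t\<bar> * \<bar>B\<bar>) ^ (2*k) /\<^sub>R fact (2*k)) < e/4"
      by (auto simp: eventually_sequentially)
    define C where "C = 2 * \<bar>t\<bar> ^ (2*k) / fact (2*k)"
    have "C \<ge> 0" by (simp add: C_def)
    then have "C * (\<integral>x. x ^ (2*k) \<partial>N) \<le> C * \<bar>B\<bar> ^ (2*k)"
      by (intro mult_left_mono moment_le)
    also have "C * \<bar>B\<bar> ^ (2*k) = 2 * ((\<bar>t\<bar> * \<bar>B\<bar>) ^ (2*k) /\<^sub>R fact (2*k))"
      unfolding C_def power_mult_distrib real_scaleR_def divide_inverse by (simp only: mult_ac)
    also note k
    finally have N_small: "C * (\<integral>x. x ^ (2*k) \<partial>N) < e/4" .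
    have "(\<lambda>n. C * (\<integral>x. x ^ (2*k) \<partial>M n)) \<longlonglongrightarrow> C * (\<integral>x. x ^ (2*k) \<partial>N)"
      by (intro tendsto_intros conv)
    then have "\<forall>\<^sub>F n in sequentially. C * (\<integral>x. x ^ (2*k) \<partial>M n) < e/4"
      using N_small by (rule order_tendstoD)
    moreover have "\<forall>\<^sub>F n in sequentially. dist (T (M n) (2*k)) (T N (2*k)) < e/4"
      by (rule tendstoD[OF T_conv]) (use \<open>e > 0\<close> in simp)
    ultimately have "\<forall>\<^sub>F n in sequentially. norm (char (M n) t - char N t) < e"
    proof eventually_elim
      case (elim n)
      have "norm (char (M n) t - char N t) \<le> norm (char (M n) t - T (M n) (2*k))
          + norm (T (M n) (2*k) - T N (2*k)) + norm (char N t - T N (2*k))"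
        using norm_triangle_ineq[of "char (M n) t - T (M n) (2*k)" "T (M n) (2*k) - T N (2*k)"]
          norm_triangle_ineq4[of "char (M n) t - T N (2*k)" "char N t - T N (2*k)"] by simp
      then show ?case
        using elim approx_M[of n k] approx_N[of k] N_small \<open>e > 0\<close> unfolding C_def dist_norm by linarith
    qed
    then show "\<exists>n0. \<forall>n\<ge>n0. norm (char (M n) t - char N t) < e"
      by (simp add: eventually_sequentially)
  qed
qed

section \<open>The arcsine law and its moments\<close>

text \<open>On \<open>{-pi..0}\<close>, unlike on \<open>{0..pi}\<close>, cosine increases, as the
  substitution rule for nonnegative integrals requires.\<close>

definition uniform_angle :: "real measure" where
  "uniform_angle = density lborel (\<lambda>u. ennreal (indicator {-pi..0} u / pi))"

lemma sets_uniform_angle [simp, measurable_cong]: "sets uniform_angle = sets borel"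
  by (simp add: uniform_angle_def)

lemma real_distribution_uniform_angle: "real_distribution uniform_angle"
proof -
  have "emeasure uniform_angle UNIV = (\<integral>\<^sup>+u. ennreal (1/pi) * indicator {-pi..0} u \<partial>lborel)"
    unfolding uniform_angle_def
    by (subst emeasure_density) (auto intro!: nn_integral_cong split: split_indicator)
  also have "\<dots> = 1"
    by (subst nn_integral_cmult_indicator) (auto simp: ennreal_mult'[symmetric])
  finally show ?thesis
    using sets_eq_imp_space_eq[OF sets_uniform_angle]
    by (intro real_distribution.intro real_distribution_axioms.intro prob_spaceI) simp_all
qed

interpretation uniform_angle: real_distribution uniform_angle
  by (rule real_distribution_uniform_angle)

text \<open>Under \<open>x = sqrt 2 * cos u\<close> the derivative \<open>- sqrt 2 * sin u\<close>
  cancels the factor \<open>1 / sqrt (2 - x\<^sup>2)\<close> and leaves the constant density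
  \<open>1 / pi\<close>.\<close>

lemma arcsine_law_eq_distr: "arcsine_law = distr uniform_angle borel (\<lambda>u. sqrt 2 * cos u)"
proof (rule measure_eqI)
  fix A assume "A \<in> sets arcsine_law"
  then have A [measurable]: "A \<in> sets borel" by (simp add: arcsine_law_def)
  let ?f = "\<lambda>x. indicator A x * (1 / pi) * (1 / sqrt (2 - x\<^sup>2)) :: real"
  let ?g = "\<lambda>u. sqrt 2 * cos u"
  \<comment> \<open>Closing the interval is harmless: at both endpoints the density is
    \<open>1 / sqrt 0\<close>, which is 0 by convention.\<close>
  have "emeasure arcsine_law A = (\<integral>\<^sup>+x. ?f x * indicator {?g (-pi)..?g 0} x \<partial>lborel)"
    unfolding arcsine_law_def
    by (subst emeasure_density)
      (auto intro!: nn_integral_cong simp: split: split_indicator)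
  also have "\<dots> = (\<integral>\<^sup>+u. ?f (?g u) * (- sqrt 2 * sin u) * indicator {-pi..0} u \<partial>lborel)"
  proof (rule nn_integral_substitution)
    show "set_borel_measurable borel {?g (-pi)..?g 0} ?f"
      unfolding set_borel_measurable_def by measurable
    show "(?g has_real_derivative - sqrt 2 * sin x) (at x)" for x
      by (auto intro!: derivative_eq_intros)
    show "0 \<le> - sqrt 2 * sin x" if "x \<in> {-pi..0}" for x
      using that sin_ge_zero[of "-x"] by (simp add: mult_le_0_iff)
  qed (auto intro!: continuous_intros)
  also have "\<dots> = (\<integral>\<^sup>+u. ennreal (indicator {-pi..0} u / pi) * indicator (?g -` A) u \<partial>lborel)"
  proof (rule nn_integral_cong_AE)
    \<comment> \<open>At these two angles \<open>sin u = 0\<close> and the cancellation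
      fails.\<close>
    have "AE u in lborel. u \<notin> {-pi, 0::real}"
      by (intro AE_not_in finite_imp_null_set_lborel) auto
    then show "AE u in lborel. ennreal (?f (?g u) * (- sqrt 2 * sin u) * indicator {-pi..0} u)
        = ennreal (indicator {-pi..0} u / pi) * indicator (?g -` A) u"
    proof eventually_elim
      case (elim u)
      show ?case
      proof (cases "u \<in> {-pi..0}")
        case True
        then have "sin u < 0" using elim sin_gt_zero[of "-u"] by auto
        moreover have "2 - (?g u)\<^sup>2 = 2 * (sin u)\<^sup>2"
          by (simp add: power_mult_distrib sin_squared_eq)
        ultimately have "sqrt (2 - (?g u)\<^sup>2) = - (sqrt 2 * sin u)"
          by (simp add: real_sqrt_mult)
        with \<open>sin u < 0\<close> True show ?thesis
          by (auto split: split_indicator)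
      qed simp
    qed
  qed
  also have "\<dots> = emeasure uniform_angle (?g -` A \<inter> space uniform_angle)"
  proof -
    have "?g -` A \<in> sets borel"
      using measurable_sets[of ?g borel borel A] by simp
    then show ?thesis
      unfolding uniform_angle_def by (simp add: emeasure_density)
  qed
  also have "\<dots> = emeasure (distr uniform_angle borel ?g) A"
    by (subst emeasure_distr) auto
  finally show "emeasure arcsine_law A = emeasure (distr uniform_angle borel ?g) A" .
qed (simp add: arcsine_law_def)

lemma real_distribution_arcsine_law: "real_distribution arcsine_law"
  unfolding arcsine_law_eq_distr by (rule uniform_angle.real_distribution_distr) simp

lemma AE_arcsine_law_bounded: "AE x in arcsine_law. \<bar>x\<bar> \<le> sqrt 2"
  unfolding arcsine_law_def by (subst AE_density) (auto split: split_indicator)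

text \<open>The number of \<open>k\<close>-step nearest-neighbour walks on the integers from the origin to \<open>j\<close>,
  as a Fourier coefficient: then \<open>walk_count k 0\<close> is a moment of the arcsine law by construction
  and no binomial coefficient has to be evaluated.\<close>

definition walk_count :: "nat \<Rightarrow> int \<Rightarrow> real" where
  "walk_count k j = (\<integral>u. (2 * cos u) ^ k * cos (of_int j * u) \<partial>uniform_angle)"

lemma integrable_uniform_angle:
  "integrable uniform_angle (\<lambda>u. (2 * cos u) ^ k * cos (of_int j * u))"
proof (rule uniform_angle.integrable_const_bound[where B = "2 ^ k"])
  have "\<bar>2 * cos u\<bar> ^ k * \<bar>cos (of_int j * u)\<bar> \<le> 2 ^ k * 1" for u :: real
    by (intro mult_mono power_mono) (auto simp: abs_mult)
  then show "AE u in uniform_angle. norm ((2 * cos u) ^ k * cos (of_int j * u)) \<le> 2 ^ k"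
    by (simp add: abs_mult power_abs)
qed auto

text \<open>For an integer \<open>j \<noteq> 0\<close> the antiderivative
  \<open>sin (j * u) / (j * pi)\<close> vanishes at both ends of the half period.\<close>

lemma walk_count_0: "walk_count 0 j = (if j = 0 then 1 else 0)"
proof (cases "j = 0")
  case True
  then show ?thesis using uniform_angle.prob_space by (simp add: walk_count_def)
next
  case False
  have "walk_count 0 j = (\<integral>u. indicator {-pi..0} u *\<^sub>R (cos (of_int j * u) / pi) \<partial>lborel)"
    unfolding walk_count_def uniform_angle_def
    by (subst integral_density) (auto intro!: Bochner_Integration.integral_cong)
  also have "\<dots> = sin (of_int j * 0) / (of_int j * pi) - sin (of_int j * (-pi)) / (of_int j * pi)"
    using False
    by (intro integral_FTC_atLeastAtMost)
      (auto intro!: derivative_eq_intros continuous_intros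
        simp: has_real_derivative_iff_has_vector_derivative[symmetric])
  also have "\<dots> = 0" using sin_zero_iff_int2[of "of_int j * pi"] by auto
  finally show ?thesis using False by simp
qed

text \<open>Product formula for \<open>2 * cos u * cos (j * u)\<close>. This is the limiting form of
  the recursion \<open>matrix_element_Suc\<close>.\<close>

lemma walk_count_Suc: "walk_count (Suc k) j = walk_count k (j - 1) + walk_count k (j + 1)"
proof -
  have "(2 * cos u) ^ Suc k * cos (of_int j * u) =
      (2 * cos u) ^ k * cos (of_int (j - 1) * u) + (2 * cos u) ^ k * cos (of_int (j + 1) * u)" for u :: real
    by (simp add: algebra_simps cos_add cos_diff)
  then show ?thesis
    unfolding walk_count_def by (simp only: Bochner_Integration.integral_add integrable_uniform_angle)
qed

lemma arcsine_law_moment: "(\<integral>x. x ^ k \<partial>arcsine_law) = walk_count k 0 / sqrt 2 ^ k"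
proof -
  have "(\<integral>x. x ^ k \<partial>arcsine_law) = (\<integral>u. (sqrt 2 * cos u) ^ k \<partial>uniform_angle)"
    unfolding arcsine_law_eq_distr by (subst integral_distr) auto
  also have "(\<lambda>u. sqrt 2 * cos u) = (\<lambda>u. 2 * cos u / sqrt 2)"
    using real_div_sqrt[of 2] by (simp add: fun_eq_iff times_divide_eq_left[symmetric] del: times_divide_eq_left)
  also have "(\<integral>u. (2 * cos u / sqrt 2) ^ k \<partial>uniform_angle) = walk_count k 0 / sqrt 2 ^ k"
    by (simp add: walk_count_def power_divide)
  finally show ?thesis .
qed

lemma borel_measurable_poly [measurable]: "poly q \<in> borel_measurable borel" for q :: "real poly"
  by (intro borel_measurable_continuous_onI continuous_intros)

section \<open>Orthogonal polynomials of a symmetric measure\<close>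

locale symmetric_jacobi = real_distribution M for M :: "real measure" +
  fixes p :: "nat \<Rightarrow> real poly" and \<omega> :: "nat \<Rightarrow> real"
  assumes symmetric: "symmetric_measure M"
    and moments: "all_moments_finite M"
    and orthogonal: "monic_orthogonal_polys M p"
    and jacobi: "jacobi_sequence p \<omega>"
    and \<omega>_pos: "\<And>n. n \<ge> 1 \<Longrightarrow> \<omega> n > 0"
begin

lemma integrable_poly: "integrable M (poly q)"
  using moments unfolding poly_altdef[abs_def] all_moments_finite_def by auto

lemma integrable_poly':
  assumes "\<And>x. f x = poly q x" shows "integrable M f"
  using integrable_poly[of q] assms by (metis ext)

abbreviation h :: "nat \<Rightarrow> real" where
  "h n \<equiv> \<integral>x. (poly (p n) x)\<^sup>2 \<partial>M"

lemma integral_p_mult: "(\<integral>x. poly (p m) x * poly (p n) x \<partial>M) = (if m = n then h n else 0)"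
  using orthogonal by (auto simp: monic_orthogonal_polys_def power2_eq_square)

lemma integrable_p_mult [simp]:
  "integrable M (\<lambda>x. poly (p m) x * poly (p n) x)"
  by (rule integrable_poly'[of _ "p m * p n"]) simp

lemma p_0: "p 0 = 1"
  using orthogonal degree_0_id[of "p 0"] unfolding monic_orthogonal_polys_def
  by (metis one_pCons)

lemma h_0: "h 0 = 1"
  using prob_space by (simp add: p_0)

lemma integral_uminus:
  fixes f :: "real \<Rightarrow> real"
  assumes [measurable]: "f \<in> borel_measurable borel"
  shows "(\<integral>x. f (- x) \<partial>M) = (\<integral>x. f x \<partial>M)"
proof -
  have "(\<integral>x. f x \<partial>M) = (\<integral>x. f x \<partial>distr M borel uminus)"
    using symmetric by (simp add: symmetric_measure_def)
  also have "\<dots> = (\<integral>x. f (- x) \<partial>M)"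
    by (subst integral_distr) auto
  finally show ?thesis ..
qed

text \<open>Integrating the recurrence against \<open>p m\<close> leaves at most one term on the
  right. The pair of indices \<open>n\<close>, \<open>Suc n\<close> gives the ratio of the norms,
  whose positivity then follows from that of \<open>\<omega>\<close>. Symmetry of the measure
  removes the diagonal coefficients.\<close>

lemma
  shows h_pos: "h n > 0"
    and p_recurrence: "x * poly (p n) x = poly (p (Suc n)) x + (if n = 0 then 0 else \<omega> n * poly (p (n - 1)) x)"
    and h_Suc: "h (Suc n) = \<omega> (Suc n) * h n"
proof -
  obtain \<alpha> where "\<And>n. [:0, 1:] * p n = p (n + 1) + smult (\<alpha> (n + 1)) (p n)
      + (if n = 0 then 0 else smult (\<omega> n) (p (n - 1)))"
    using jacobi unfolding jacobi_sequence_def by auto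
  from arg_cong[OF this, of "\<lambda>q. poly q x" for x]
  have rec: "x * poly (p n) x = poly (p (Suc n)) x + \<alpha> (Suc n) * poly (p n) x
      + (if n = 0 then 0 else \<omega> n * poly (p (n - 1)) x)" for n x
    by (simp split: if_splits)
  have expand: "(\<integral>x. x * poly (p n) x * poly (p m) x \<partial>M) =
      (if m = Suc n then h m else 0) + \<alpha> (Suc n) * (if m = n then h m else 0)
      + (if Suc m = n then \<omega> n * h m else 0)" for n m
  proof -
    have "(\<integral>x. x * poly (p n) x * poly (p m) x \<partial>M) =
      (\<integral>x. poly (p (Suc n)) x * poly (p m) x + \<alpha> (Suc n) * (poly (p n) x * poly (p m) x)
      + (if n = 0 then 0 else \<omega> n) * (poly (p (n - 1)) x * poly (p m) x) \<partial>M)"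
      by (subst rec) (auto intro!: Bochner_Integration.integral_cong simp: algebra_simps)
    also have "\<dots> = (if Suc n = m then h m else 0) + \<alpha> (Suc n) * (if n = m then h m else 0)
      + (if n = 0 then 0 else \<omega> n) * (if n - 1 = m then h m else 0)"
      by (simp add: integral_p_mult)
    finally show ?thesis by (cases n) auto
  qed
  have h_Suc: "h (Suc n) = \<omega> (Suc n) * h n" for n
  proof -
    \<comment> \<open>One integral is expanded in two ways, with \<open>x\<close> absorbed into
      either factor.\<close>
    have "(\<integral>x. x * poly (p n) x * poly (p (Suc n)) x \<partial>M) =
        (\<integral>x. x * poly (p (Suc n)) x * poly (p n) x \<partial>M)"
      by (simp add: mult_ac)
    then show ?thesis unfolding expand by simp
  qed
  have h_pos: "h n > 0" for n
  proof (induction n)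
    case (Suc n)
    then show ?case using \<omega>_pos[of "Suc n"] by (simp add: h_Suc del: power_Suc)
  qed (simp add: h_0)
  \<comment> \<open>If \<open>p n\<close> has a parity, then \<open>x\<close> times its square is
    odd and integrates to 0.\<close>
  have \<alpha>_0: "\<alpha> (Suc n) = 0" if "\<And>x. poly (p n) (- x) = (-1) ^ n * poly (p n) x" for n
  proof -
    have "(\<integral>x. x * poly (p n) x * poly (p n) x \<partial>M) = (\<integral>x. - x * poly (p n) (- x) * poly (p n) (- x) \<partial>M)"
      by (rule integral_uminus[symmetric]) simp
    also have "\<dots> = - (\<integral>x. x * poly (p n) x * poly (p n) x \<partial>M)"
      by (simp add: that mult_ac)
    finally have "(\<integral>x. x * poly (p n) x * poly (p n) x \<partial>M) = 0" by simp
    then show ?thesis unfolding expand using h_pos[of n] by simp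
  qed
  \<comment> \<open>The two facts interlock: the parity of \<open>p m\<close> kills
    \<open>\<alpha> (Suc m)\<close>, and the recurrence without that term passes the parity on to
    \<open>p (Suc m)\<close>.\<close>
  have parity: "\<forall>x. poly (p n) (- x) = (-1) ^ n * poly (p n) x" for n
  proof (induction n rule: less_induct)
    case (less n)
    show ?case
    proof (cases n)
      case 0
      then show ?thesis by (simp add: p_0)
    next
      case (Suc m)
      have "poly (p (Suc m)) y = y * poly (p m) y - (if m = 0 then 0 else \<omega> m * poly (p (m - 1)) y)" for y
        using rec[of y m] \<alpha>_0[of m] less[of m] Suc by simp
      then show ?thesis
        using less[of m] less[of "m - 1"] Suc by (cases m) (simp_all add: right_diff_distrib mult_ac)
    qed
  qed
  show "h n > 0" "h (Suc n) = \<omega> (Suc n) * h n" by (fact h_pos h_Suc)+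
  show "x * poly (p n) x = poly (p (Suc n)) x + (if n = 0 then 0 else \<omega> n * poly (p (n - 1)) x)"
    using rec[of x n] \<alpha>_0[of n] parity[of n] by simp
qed

section \<open>Orthonormal polynomials and powers of the Jacobi matrix\<close>

abbreviation P :: "nat \<Rightarrow> real \<Rightarrow> real" where
  "P n \<equiv> poly (normalized_poly M (p n))"

lemma P_eq: "P n x = poly (p n) x / sqrt (h n)"
  by (simp add: normalized_poly_def L2_norm_poly_def)

text \<open>By \<open>h_Suc\<close> consecutive norms differ by the factor
  \<open>sqrt (\<omega> n)\<close>, so normalization makes the tridiagonal matrix symmetric.\<close>

lemma P_recurrence:
  assumes "n \<ge> 1"
  shows "x * P n x = sqrt (\<omega> (Suc n)) * P (Suc n) x + sqrt (\<omega> n) * P (n - 1) x"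
proof -
  obtain m where m: "n = Suc m" using assms by (cases n) auto
  have "\<omega> n > 0" "\<omega> (Suc n) > 0" using \<omega>_pos[of n] \<omega>_pos[of "Suc n"] assms by auto
  moreover have "h n = \<omega> n * h (n - 1)" "h (Suc n) = \<omega> (Suc n) * h n"
    using h_Suc[of "n - 1"] h_Suc[of n] m by auto
  moreover have "h (n - 1) > 0" by (rule h_pos)
  ultimately have "sqrt (\<omega> (Suc n)) * P (Suc n) x + sqrt (\<omega> n) * P (n - 1) x
      = (poly (p (Suc n)) x + \<omega> n * poly (p (n - 1)) x) / sqrt (h n)"
    unfolding P_eq by (simp add: real_sqrt_mult divide_simps)
  also have "\<dots> = x * P n x"
    using p_recurrence[of x n] assms unfolding P_eq by simp
  finally show ?thesis ..
qed

text \<open>Entry \<open>(n, m)\<close> of the \<open>k\<close>-th power of the Jacobi matrix, given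
  as an integral so that no infinite matrices are multiplied. Moments use only the diagonal, but the
  recursion in \<open>k\<close> leaves it.\<close>

definition matrix_element :: "nat \<Rightarrow> nat \<Rightarrow> nat \<Rightarrow> real" where
  "matrix_element k n m = (\<integral>x. x ^ k * P n x * P m x \<partial>M)"

lemma integrable_matrix_element: "integrable M (\<lambda>x. x ^ k * P n x * P m x)"
  by (rule integrable_poly'[of _ "monom 1 k * normalized_poly M (p n) * normalized_poly M (p m)"])
    (simp add: poly_monom)

lemma matrix_element_0: "matrix_element 0 n m = (if n = m then 1 else 0)"
  using h_pos[of n] h_pos[of m]
  by (simp add: matrix_element_def P_eq integral_p_mult)

lemma matrix_element_Suc:
  assumes "n \<ge> 1"
  shows "matrix_element (Suc k) n m =
    sqrt (\<omega> (Suc n)) * matrix_element k (Suc n) m + sqrt (\<omega> n) * matrix_element k (n - 1) m"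
proof -
  have "x ^ Suc k * P n x * P m x = sqrt (\<omega> (Suc n)) * (x ^ k * P (Suc n) x * P m x)
      + sqrt (\<omega> n) * (x ^ k * P (n - 1) x * P m x)" for x
  proof -
    have "x ^ Suc k * P n x * P m x = x ^ k * (x * P n x) * P m x" by simp
    then show ?thesis unfolding P_recurrence[OF assms] by (simp add: algebra_simps)
  qed
  then show ?thesis
    unfolding matrix_element_def by (simp add: integrable_matrix_element)
qed

text \<open>Induction on \<open>k\<close>. The recursion shifts the left index by one and keeps the
  right one, so the offset \<open>j\<close> changes by one and has to be general. The weights tend
  to 1, which turns the recursion into \<open>walk_count_Suc\<close>.\<close>

lemma matrix_element_tendsto:
  assumes ratio: "(\<lambda>n. \<omega> (n + 1) / \<omega> n) \<longlonglongrightarrow> 1"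
  shows "(\<lambda>n. matrix_element k n (nat (int n + j)) / sqrt (\<omega> n) ^ k) \<longlonglongrightarrow> walk_count k j"
proof (induction k arbitrary: j)
  case 0
  \<comment> \<open>From \<open>n = 1\<close> on, truncation by \<open>nat\<close> cannot move a
    negative offset onto the diagonal.\<close>
  have "\<forall>\<^sub>F n in sequentially. walk_count 0 j = matrix_element 0 n (nat (int n + j)) / sqrt (\<omega> n) ^ 0"
    using eventually_ge_at_top[of 1]
    by eventually_elim (auto simp: matrix_element_0 walk_count_0)
  then show ?case by (rule Lim_transform_eventually[OF tendsto_const])
next
  case (Suc k)
  define s where "s n = sqrt (\<omega> n)" for n
  have s_pos: "s n > 0" if "n \<ge> 1" for n using \<omega>_pos[OF that] by (simp add: s_def)
  define a where "a j n = matrix_element k n (nat (int n + j)) / s n ^ k" for j n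
  have a: "a j \<longlonglongrightarrow> walk_count k j" for j
    using Suc[of j] by (simp add: a_def[abs_def] s_def)
  have pred: "filterlim (\<lambda>n::nat. n - 1) sequentially sequentially"
    by (rule filterlim_minus_const_nat_at_top)
  have up: "(\<lambda>n. s (Suc n) / s n) \<longlonglongrightarrow> 1"
    using tendsto_real_sqrt[OF ratio] by (simp add: s_def real_sqrt_divide)
  have down: "(\<lambda>n. inverse (s (Suc (n - 1)) / s (n - 1))) \<longlonglongrightarrow> 1"
    using tendsto_inverse[OF filterlim_compose[OF up pred]] by simp
  \<comment> \<open>The exponents differ because the recursion supplies a factor
    \<open>s (Suc n)\<close> upwards but \<open>s n\<close> downwards, and the latter cancels one
    power of the normalization \<open>s n ^ Suc k\<close>.\<close>
  have "(\<lambda>n. (s (Suc n) / s n) ^ Suc k * a (j - 1) (Suc n)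
        + inverse (s (Suc (n - 1)) / s (n - 1)) ^ k * a (j + 1) (n - 1))
      \<longlonglongrightarrow> 1 ^ Suc k * walk_count k (j - 1) + 1 ^ k * walk_count k (j + 1)"
    by (intro tendsto_intros up down LIMSEQ_Suc a filterlim_compose[OF a pred])
  then have "(\<lambda>n. (s (Suc n) / s n) ^ Suc k * a (j - 1) (Suc n)
        + inverse (s (Suc (n - 1)) / s (n - 1)) ^ k * a (j + 1) (n - 1)) \<longlonglongrightarrow> walk_count (Suc k) j"
    by (simp add: walk_count_Suc)
  moreover have "\<forall>\<^sub>F n in sequentially. (s (Suc n) / s n) ^ Suc k * a (j - 1) (Suc n)
        + inverse (s (Suc (n - 1)) / s (n - 1)) ^ k * a (j + 1) (n - 1)
      = matrix_element (Suc k) n (nat (int n + j)) / s n ^ Suc k"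
    \<comment> \<open>The bound 2 ensures \<open>n - 1 \<ge> 1\<close>, hence
      \<open>s (n - 1) > 0\<close>.\<close>
    using eventually_ge_at_top[of 2]
  proof eventually_elim
    case (elim n)
    define b where "b = matrix_element k (Suc n) (nat (int n + j))"
    define c where "c = matrix_element k (n - 1) (nat (int n + j))"
    have pos: "s n > 0" "s (Suc n) > 0" "s (n - 1) > 0" using elim by (auto intro!: s_pos)
    have idx: "int (Suc n) + (j - 1) = int n + j" "int (n - 1) + (j + 1) = int n + j" "Suc (n - 1) = n"
      using elim by auto
    have "a (j - 1) (Suc n) = b / s (Suc n) ^ k" "a (j + 1) (n - 1) = c / s (n - 1) ^ k"
      unfolding a_def idx b_def c_def by simp_all
    moreover have "matrix_element (Suc k) n (nat (int n + j)) = s (Suc n) * b + s n * c"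
      using matrix_element_Suc[of n k "nat (int n + j)"] elim by (simp add: s_def b_def c_def)
    ultimately show ?case
      unfolding idx using pos by (simp add: power_divide power_inverse field_simps)
  qed
  ultimately show ?case
    unfolding s_def[symmetric] by (rule Lim_transform_eventually)
qed

section \<open>The rescaled measures and their moments\<close>

text \<open>Pulling the density back along the rescaling cancels the factor
  \<open>sqrt (2 * \<omega> n)\<close> in the argument of the polynomial, since it is
  nonzero.\<close>

lemma scaled_poly_measure_eq:
  assumes "n \<ge> 1"
  shows "scaled_poly_measure M p \<omega> n =
    distr (density M (\<lambda>x. ennreal ((P n x)\<^sup>2))) borel (\<lambda>x. x / sqrt (2 * \<omega> n))"
  using \<omega>_pos[OF assms] unfolding scaled_poly_measure_def rescaled_measure_def
  by (subst density_distr) auto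

lemma real_distribution_scaled:
  assumes "n \<ge> 1"
  shows "real_distribution (scaled_poly_measure M p \<omega> n)"
proof -
  have "emeasure (density M (\<lambda>x. ennreal ((P n x)\<^sup>2))) UNIV = (\<integral>\<^sup>+x. ennreal ((P n x)\<^sup>2) \<partial>M)"
    by (subst emeasure_density) auto
  also have "\<dots> = ennreal (matrix_element 0 n n)"
    using integrable_matrix_element[of 0 n n]
    by (subst nn_integral_eq_integral) (auto simp: matrix_element_def power2_eq_square)
  finally have "prob_space (density M (\<lambda>x. ennreal ((P n x)\<^sup>2)))"
    by (intro prob_spaceI) (simp add: matrix_element_0)
  then show ?thesis
    unfolding scaled_poly_measure_eq[OF assms] by (rule prob_space.real_distribution_distr) simp
qed

lemma moments_scaled:
  assumes "n \<ge> 1"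
  shows "integrable (scaled_poly_measure M p \<omega> n) (\<lambda>x. x ^ k)"
    and "(\<integral>x. x ^ k \<partial>scaled_poly_measure M p \<omega> n)
      = matrix_element k n n / sqrt (\<omega> n) ^ k / sqrt 2 ^ k"
proof -
  have eq: "(P n x)\<^sup>2 *\<^sub>R (x / sqrt (2 * \<omega> n)) ^ k = (x ^ k * P n x * P n x) / (sqrt 2 * sqrt (\<omega> n)) ^ k" for x
    by (simp add: power_divide power2_eq_square real_sqrt_mult)
  show "integrable (scaled_poly_measure M p \<omega> n) (\<lambda>x. x ^ k)"
    unfolding scaled_poly_measure_eq[OF assms]
    by (subst integrable_distr_eq, simp, simp, subst integrable_density)
      (auto simp only: eq intro!: integrable_divide_zero integrable_matrix_element, auto)
  have "(\<integral>x. x ^ k \<partial>scaled_poly_measure M p \<omega> n) = (\<integral>x. (P n x)\<^sup>2 *\<^sub>R (x / sqrt (2 * \<omega> n)) ^ k \<partial>M)"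
    unfolding scaled_poly_measure_eq[OF assms]
    by (subst integral_distr, simp, simp, subst integral_density) auto
  then show "(\<integral>x. x ^ k \<partial>scaled_poly_measure M p \<omega> n)
      = matrix_element k n n / sqrt (\<omega> n) ^ k / sqrt 2 ^ k"
    unfolding eq by (simp add: matrix_element_def power_mult_distrib mult.commute)
qed

lemma weak_conv_arcsine_law:
  assumes ratio: "(\<lambda>n. \<omega> (n + 1) / \<omega> n) \<longlonglongrightarrow> 1"
  shows "weak_conv_m (scaled_poly_measure M p \<omega>) arcsine_law"
proof (rule weak_conv_m_Suc, rule weak_conv_m_of_moments[where B = "sqrt 2"])
  show "(\<lambda>n. \<integral>x. x ^ k \<partial>scaled_poly_measure M p \<omega> (Suc n)) \<longlonglongrightarrow> (\<integral>x. x ^ k \<partial>arcsine_law)" for k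
  proof -
    \<comment> \<open>The diagonal is the offset \<open>j = 0\<close>. The factor
      \<open>sqrt 2 ^ k\<close> comes from the 2 in \<open>sqrt (2 * \<omega> n)\<close> and matches
      the one in \<open>arcsine_law_moment\<close>.\<close>
    have "(\<lambda>n. matrix_element k n n / sqrt (\<omega> n) ^ k / sqrt 2 ^ k) \<longlonglongrightarrow> walk_count k 0 / sqrt 2 ^ k"
      using matrix_element_tendsto[OF ratio, of k 0] by (intro tendsto_intros) simp_all
    from LIMSEQ_Suc[OF this] show ?thesis
      by (simp add: moments_scaled(2) arcsine_law_moment)
  qed
  \<comment> \<open>the shift by one avoids \<open>\<omega> 0\<close>, which is unconstrained\<close>
qed (use AE_arcsine_law_bounded in
      \<open>simp_all add: real_distribution_scaled moments_scaled(1) real_distribution_arcsine_law\<close>)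

end

theorem theorem4p1:
  fixes \<mu> :: "real measure" and p :: "nat \<Rightarrow> real poly" and \<omega> :: "nat \<Rightarrow> real"
  assumes "real_distribution \<mu>"
    and "symmetric_measure \<mu>"
    and "all_moments_finite \<mu>"
    and "monic_orthogonal_polys \<mu> p"
    and "jacobi_sequence p \<omega>"
    and "\<And>n. n \<ge> 1 \<Longrightarrow> \<omega> n > 0"
    and "(\<lambda>n. \<omega> (n + 1) / \<omega> n) \<longlonglongrightarrow> 1"
  shows "weak_conv_m (\<lambda>n. scaled_poly_measure \<mu> p \<omega> n) arcsine_law"
proof -
  interpret \<mu>: real_distribution \<mu> by fact
  interpret symmetric_jacobi \<mu> p \<omega> by unfold_locales fact+
  show ?thesis using weak_conv_arcsine_law[OF assms(7)] .
qed

end
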